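(* Let $d,T\ge 1$ be integers, $D,G>0$, $\mathcal{D}=\{\mathbf{w}\in\mathbb{R}^d:\|\mathbf{w}\|\le D/2\}$. Let $f_1,\dots,f_T:\mathcal{D}\to\mathbb{R}$ be convex loss functions with $\max_{\mathbf{w}\in\mathcal{D}}\|\nabla f_t(\mathbf{w})\|\le G$ for all $t\in\{1,\dots,T\}$. Let $S\in[0,DT]$ be a switching cost budget. Let $\mathbf{w}_1\in\mathcal{D}$ and let online gradient descent be run as $$\mathbf{w}_{t+1}=\Pi_{\mathcal{D}}\left[\mathbf{w}_t-\eta\nabla f_t(\mathbf{w}_t)\right],$$ with step size $$\eta=\begin{cases}\dfrac{D}{G\sqrt{T}}, & S\in[D\sqrt{T},DT],\\[6pt] \dfrac{S}{GT}, & S\in[0,D\sqrt{T}).\end{cases}$$ Then $$\sum_{t=2}^T\|\mathbf{w}_t-\mathbf{w}_{t-1}\|\le S,$$ and the regret $R=\sum_{t=1}^T f_t(\mathbf{w}_t)-\min_{\mathbf{w}\in\mathcal{D}}\sum_{t=1}^T f_t(\mathbf{w})$ satisfies $$R\ \le\ \begin{cases}DG\sqrt{T}, & S\in[D\sqrt{T},DT],\\[2pt] DG\,\dfrac{DT}{S}, & S\in[D,D\sqrt{T}),\\[4pt] DGT, & S\in[0,D).\end{cases}$$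
   Context: $\|\cdot\|$ is the Euclidean norm. $\Pi_{\mathcal{D}}[\mathbf{p}]=\operatorname{argmin}_{\mathbf{w}\in\mathcal{D}}(\mathbf{w}-\mathbf{p})^\top(\mathbf{w}-\mathbf{p})$ is the Euclidean projection onto $\mathcal{D}$. A function $f:\mathcal{D}\to\mathbb{R}$ (with gradient $\nabla f$) is convex if $f(\mathbf{w}_1)\ge f(\mathbf{w}_2)+\nabla f(\mathbf{w}_2)^\top(\mathbf{w}_1-\mathbf{w}_2)$ for all $\mathbf{w}_1,\mathbf{w}_2\in\mathcal{D}$. Protocol: in each round $t$ the player selects $\mathbf{w}_t\in\mathcal{D}$, after which $f_t$ is revealed (possibly chosen depending on $\mathbf{w}_1,\dots,\mathbf{w}_t$). *)

theory Defs
  imports "HOL-Analysis.Analysis"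
begin

text \<open>The gradient is taken relative to the domain \<open>K\<close>, so that it also makes sense at boundary
  points of \<open>K\<close> and ignores values of \<open>f\<close> outside \<open>K\<close>.  It is meaningful for \<open>f\<close> differentiable
  on \<open>K\<close>, and unique there if \<open>K\<close> is a closed ball of positive radius; see the lemmas below.\<close>

definition gradient_within :: "'a::euclidean_space set \<Rightarrow> ('a \<Rightarrow> real) \<Rightarrow> 'a \<Rightarrow> 'a" where
  "gradient_within K f w = (SOME g. (f has_derivative (\<lambda>h. g \<bullet> h)) (at w within K))"

lemma has_derivative_gradient_within:
  assumes "f differentiable (at w within K)"
  shows "(f has_derivative (\<lambda>h. gradient_within K f w \<bullet> h)) (at w within K)"
proof -
  obtain f' where f': "(f has_derivative f') (at w within K)"
    using assms by (auto simp: differentiable_def)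
  then have "linear f'"
    by (rule has_derivative_linear)
  then have "f' = (\<lambda>h. adjoint f' 1 \<bullet> h)"
    using adjoint_works[of f' _ 1] by (auto simp: inner_commute fun_eq_iff)
  with f' have "\<exists>g. (f has_derivative (\<lambda>h. g \<bullet> h)) (at w within K)"
    by metis
  then show ?thesis
    unfolding gradient_within_def by (rule someI_ex)
qed

lemma gradient_within_cball_unique:
  assumes "(f has_derivative (\<lambda>h. g \<bullet> h)) (at w within cball c r)"
    and "0 < r" "w \<in> cball c r"
  shows "gradient_within (cball c r) f w = g"
proof -
  define g' where "g' = gradient_within (cball c r) f w"
  have g': "(f has_derivative (\<lambda>h. g' \<bullet> h)) (at w within cball c r)"
    unfolding g'_def using assms(1)
    by (intro has_derivative_gradient_within) (auto simp: differentiable_def)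
  have directional: "((\<lambda>s. f (w + s *\<^sub>R (z - w))) has_vector_derivative v \<bullet> (z - w))
      (at 0 within {0..1})"
    if v: "(f has_derivative (\<lambda>h. v \<bullet> h)) (at w within cball c r)" and z: "z \<in> cball c r"
    for v z
  proof -
    have "w + s *\<^sub>R (z - w) \<in> cball c r" if "s \<in> {0..1}" for s :: real
      using convexD_alt[OF convex_cball assms(3) z, of s] that by (simp add: algebra_simps)
    then have sub: "(\<lambda>s. w + s *\<^sub>R (z - w)) ` {0..1} \<subseteq> cball c r"
      by blast
    have "((\<lambda>s. w + s *\<^sub>R (z - w)) has_derivative (\<lambda>s. s *\<^sub>R (z - w))) (at 0 within {0..1})"
      by (auto intro!: derivative_eq_intros)
    moreover have "(f has_derivative (\<lambda>h. v \<bullet> h))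
        (at (w + 0 *\<^sub>R (z - w)) within (\<lambda>s. w + s *\<^sub>R (z - w)) ` {0..1})"
      using has_derivative_subset[OF v sub] by simp
    ultimately have "((\<lambda>s. f (w + s *\<^sub>R (z - w))) has_derivative (\<lambda>s. v \<bullet> (s *\<^sub>R (z - w))))
        (at 0 within {0..1})"
      by (rule has_derivative_in_compose)
    then show ?thesis
      by (simp add: has_vector_derivative_def)
  qed
  have eq: "g' \<bullet> (z - w) = g \<bullet> (z - w)" if "z \<in> cball c r" for z
    by (rule vector_derivative_unique_within[OF _ directional[OF g' that]
          directional[OF assms(1) that]]) (simp add: trivial_limit_within islimpt_Icc)
  define s where "s = r / (norm (g' - g) + 1)"
  have "norm (g' - g) * r \<le> r * (norm (g' - g) + 1)"
    using assms(2) by (simp add: algebra_simps)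
  then have "s * norm (g' - g) \<le> r"
    unfolding s_def by (simp add: divide_simps mult.commute add_nonneg_pos)
  moreover have s: "s > 0"
    unfolding s_def using assms(2) by (simp add: add_nonneg_pos)
  ultimately have "c + s *\<^sub>R (g' - g) \<in> cball c r" "c \<in> cball c r"
    using assms(2) by (auto simp: dist_norm)
  from this[THEN eq] have "s * ((g' - g) \<bullet> (g' - g)) = 0"
    by (simp add: algebra_simps inner_commute)
  with s show ?thesis
    unfolding g'_def by simp
qed

definition convex_loss_on :: "'a::euclidean_space set \<Rightarrow> ('a \<Rightarrow> real) \<Rightarrow> bool" where
  "convex_loss_on K f \<longleftrightarrow> f differentiable_on K \<and>
     (\<forall>w1\<in>K. \<forall>w2\<in>K. f w1 \<ge> f w2 + gradient_within K f w2 \<bullet> (w1 - w2))"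

definition euclidean_projection :: "'a::euclidean_space set \<Rightarrow> 'a \<Rightarrow> 'a" where
  "euclidean_projection K p = arg_min_on (\<lambda>w. (w - p) \<bullet> (w - p)) K"

lemma euclidean_projection_eq_closest_point:
  "euclidean_projection K p = closest_point K p"
  unfolding euclidean_projection_def arg_min_on_def arg_min_def is_arg_min_linorder
    closest_point_def
  by (simp add: dist_norm norm_le norm_minus_commute[of p] Ball_def)

text \<open>The minimum of the cumulative loss over \<open>K\<close> is its value at a minimizer; for continuous
  losses on a nonempty compact \<open>K\<close> a minimizer exists.\<close>

definition regret ::
    "'a::euclidean_space set \<Rightarrow> nat \<Rightarrow> (nat \<Rightarrow> 'a \<Rightarrow> real) \<Rightarrow> (nat \<Rightarrow> 'a) \<Rightarrow> real" where
  "regret K T f w =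
     (let F = (\<lambda>u. \<Sum>t=1..T. f t u)
      in (\<Sum>t=1..T. f t (w t)) - F (arg_min_on F K))"

lemma regret_minimum:
  fixes f :: "nat \<Rightarrow> 'a::euclidean_space \<Rightarrow> real"
  assumes "compact K" "K \<noteq> {}" "\<And>t. t \<in> {1..T} \<Longrightarrow> continuous_on K (f t)"
  defines "u \<equiv> arg_min_on (\<lambda>u. \<Sum>t=1..T. f t u) K"
  shows "u \<in> K" "\<And>v. v \<in> K \<Longrightarrow> (\<Sum>t=1..T. f t u) \<le> (\<Sum>t=1..T. f t v)"
proof -
  have "continuous_on K (\<lambda>u. \<Sum>t=1..T. f t u)"
    using assms(3) by (intro continuous_on_sum) auto
  then have "\<exists>x. is_arg_min (\<lambda>u. \<Sum>t=1..T. f t u) (\<lambda>x. x \<in> K) x"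
    using continuous_attains_inf[OF assms(1,2)] by (simp add: is_arg_min_linorder Ball_def Bex_def)
  from someI_ex[OF this] have "is_arg_min (\<lambda>u. \<Sum>t=1..T. f t u) (\<lambda>x. x \<in> K) u"
    unfolding u_def arg_min_on_def arg_min_def .
  then show "u \<in> K" "\<And>v. v \<in> K \<Longrightarrow> (\<Sum>t=1..T. f t u) \<le> (\<Sum>t=1..T. f t v)"
    by (auto simp: is_arg_min_linorder)
qed

end

theory Submission
  imports Defs
begin

text \<open>The projection is nonexpansive and fixes \<open>K\<close>, so each step has length at most
  \<open>\<eta> * G\<close>.  Nonexpansiveness relative to a comparator \<open>u \<in> K\<close> makes
  \<open>(norm (w t - u))\<^sup>2\<close> a potential whose telescoping bounds the regret by
  \<open>D\<^sup>2 / (2 * \<eta>) + \<eta> * G\<^sup>2 * T / 2\<close>.  For \<open>S < D\<close> the regret bound is the trivial one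
  coming from \<open>norm (w t - u) \<le> D\<close>.\<close>

lemma closest_point_nonexpansive_to_member:
  fixes K :: "'a::euclidean_space set"
  assumes "convex K" "closed K" "u \<in> K"
  shows "norm (closest_point K x - u) \<le> norm (x - u)"
  using closest_point_lipschitz[of K x u] closest_point_self[OF assms(3)] assms
  by (auto simp: dist_norm)

text \<open>Dropping the projection only increases the distance to \<open>u\<close>; expanding the
  square of the unprojected step then produces the inner product as cross term. The difference of
  squares is the decrease of the potential.\<close>

lemma projected_gradient_step:
  fixes K :: "'a::euclidean_space set"
  assumes "convex K" "closed K" "u \<in> K" "0 \<le> \<eta>" "norm g \<le> G"
  shows "2 * \<eta> * (g \<bullet> (x - u))
    \<le> (norm (x - u))\<^sup>2 - (norm (closest_point K (x - \<eta> *\<^sub>R g) - u))\<^sup>2 + \<eta>\<^sup>2 * G\<^sup>2"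
proof -
  have "(norm (closest_point K (x - \<eta> *\<^sub>R g) - u))\<^sup>2 \<le> (norm ((x - u) - \<eta> *\<^sub>R g))\<^sup>2"
    using closest_point_nonexpansive_to_member[OF assms(1-3), of "x - \<eta> *\<^sub>R g"]
    by (intro power_mono) (simp_all add: algebra_simps)
  also have "\<dots> = (norm (x - u))\<^sup>2 - 2 * \<eta> * (g \<bullet> (x - u)) + \<eta>\<^sup>2 * (norm g)\<^sup>2"
    unfolding power2_norm_eq_inner by (simp add: algebra_simps inner_commute power2_eq_square)
  also have "\<eta>\<^sup>2 * (norm g)\<^sup>2 \<le> \<eta>\<^sup>2 * G\<^sup>2"
    using assms(5) by (intro mult_left_mono power_mono) auto
  finally show ?thesis
    by simp
qed

lemma projected_iterates_mem:
  fixes K :: "'a::euclidean_space set"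
  assumes "closed K" "w 1 \<in> K"
    and "\<And>t. t \<in> {1..<T} \<Longrightarrow> w (Suc t) = closest_point K (p t)"
    and "t \<in> {1..T}"
  shows "w t \<in> K"
proof (cases "t = 1")
  case False
  with assms(4) obtain s where s: "t = Suc s" "s \<in> {1..<T}"
    by (cases t) auto
  have "K \<noteq> {}"
    using assms(2) by auto
  then show ?thesis
    using assms(1,3) s closest_point_in_set by metis
qed (use assms(2) in simp)

text \<open>The previous iterate lies in \<open>K\<close>, so it can itself serve as the comparator:
  projecting brings the gradient step no farther from its starting point.\<close>

lemma projected_descent_path_length:
  fixes K :: "'a::euclidean_space set"
  assumes "convex K" "closed K" "0 \<le> \<eta>" "0 \<le> G"
    and "\<And>t. t \<in> {1..T} \<Longrightarrow> w t \<in> K"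
    and "\<And>t. t \<in> {1..T} \<Longrightarrow> norm (g t) \<le> G"
    and step: "\<And>t. t \<in> {1..<T} \<Longrightarrow> w (Suc t) = closest_point K (w t - \<eta> *\<^sub>R g t)"
  shows "(\<Sum>t=2..T. norm (w t - w (t - 1))) \<le> T * (\<eta> * G)"
proof -
  have "norm (w t - w (t - 1)) \<le> \<eta> * G" if t: "t \<in> {2..T}" for t
  proof -
    obtain s where s: "t = Suc s" "s \<in> {1..<T}"
      using t by (cases t) auto
    then have "norm (w t - w s) \<le> norm ((w s - \<eta> *\<^sub>R g s) - w s)"
      using closest_point_nonexpansive_to_member[OF assms(1,2,5), of s "w s - \<eta> *\<^sub>R g s"] step[of s]
      by simp
    also have "\<dots> \<le> \<eta> * G"
      using assms(3) assms(6)[of s] s by (simp add: mult_left_mono)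
    finally show ?thesis
      using s by simp
  qed
  then have "(\<Sum>t=2..T. norm (w t - w (t - 1))) \<le> (\<Sum>t=2..T. \<eta> * G)"
    by (intro sum_mono)
  \<comment> \<open>The \<open>T - 1\<close> moves are rounded up to \<open>T\<close>, which costs
    nothing later because the step sizes are scaled by \<open>T\<close> rounds.\<close>
  also have "\<dots> \<le> T * (\<eta> * G)"
    using assms(3,4) by (auto intro!: mult_right_mono)
  finally show ?thesis .
qed

lemma projected_descent_linear_regret:
  fixes K :: "'a::euclidean_space set"
  assumes "convex K" "closed K" "u \<in> K" "0 < \<eta>" "T \<ge> 1"
    and "\<And>t. t \<in> {1..T} \<Longrightarrow> norm (g t) \<le> G"
    and step: "\<And>t. t \<in> {1..<T} \<Longrightarrow> w (Suc t) = closest_point K (w t - \<eta> *\<^sub>R g t)"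
  shows "(\<Sum>t=1..T. g t \<bullet> (w t - u)) \<le> (norm (w 1 - u))\<^sup>2 / (2 * \<eta>) + \<eta> * G\<^sup>2 * T / 2"
proof -
  \<comment> \<open>The hypotheses say nothing about \<open>w (Suc T)\<close>. Appending one more
    step in \<open>v\<close> gives the last round a successor, so that all \<open>T\<close> rounds
    telescope.\<close>
  define v where "v = w(Suc T := closest_point K (w T - \<eta> *\<^sub>R g T))"
  have v: "v t = w t" if "t \<in> {1..T}" for t
    using that by (simp add: v_def)
  have v_step: "v (Suc t) = closest_point K (w t - \<eta> *\<^sub>R g t)" if "t \<in> {1..T}" for t
    using that step[of t] by (cases "t = T") (auto simp: v_def)
  have "2 * \<eta> * (\<Sum>t=1..T. g t \<bullet> (w t - u))
      \<le> (\<Sum>t=1..T. (norm (v t - u))\<^sup>2 - (norm (v (Suc t) - u))\<^sup>2 + \<eta>\<^sup>2 * G\<^sup>2)"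
    unfolding sum_distrib_left
  proof (rule sum_mono)
    fix t assume t: "t \<in> {1..T}"
    show "2 * \<eta> * (g t \<bullet> (w t - u)) \<le> (norm (v t - u))\<^sup>2 - (norm (v (Suc t) - u))\<^sup>2 + \<eta>\<^sup>2 * G\<^sup>2"
      unfolding v[OF t] v_step[OF t]
      using assms t by (intro projected_gradient_step) auto
  qed
  also have "\<dots> = (norm (v 1 - u))\<^sup>2 - (norm (v (Suc T) - u))\<^sup>2 + T * (\<eta>\<^sup>2 * G\<^sup>2)"
  proof -
    have "(\<Sum>t=1..T. (norm (v t - u))\<^sup>2 - (norm (v (Suc t) - u))\<^sup>2)
        = (norm (v 1 - u))\<^sup>2 - (norm (v (Suc T) - u))\<^sup>2"
      using sum_Suc_diff[of 1 T "\<lambda>t. - (norm (v t - u))\<^sup>2"] assms(5) by simp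
    then show ?thesis
      by (simp add: sum.distrib)
  qed
  also have "\<dots> \<le> (norm (w 1 - u))\<^sup>2 + T * (\<eta>\<^sup>2 * G\<^sup>2)"
    using assms(5) v by simp
  finally show ?thesis
    using assms(4) by (simp add: field_simps power2_eq_square)
qed

text \<open>Compactness provides a minimizer \<open>u\<close> of the cumulative loss; the
  first-order convexity inequality based at \<open>w t\<close> then bounds the gap to
  \<open>u\<close> in each round.\<close>

lemma regret_le_linear_regret:
  fixes K :: "'a::euclidean_space set"
  assumes "compact K" "K \<noteq> {}"
    and loss: "\<And>t. t \<in> {1..T} \<Longrightarrow> convex_loss_on K (f t)"
    and w: "\<And>t. t \<in> {1..T} \<Longrightarrow> w t \<in> K"
  obtains u where "u \<in> K"
    "regret K T f w \<le> (\<Sum>t=1..T. gradient_within K (f t) (w t) \<bullet> (w t - u))"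
proof -
  define u where "u = arg_min_on (\<lambda>u. \<Sum>t=1..T. f t u) K"
  have "u \<in> K"
    unfolding u_def
    using assms by (intro regret_minimum(1))
      (auto simp: convex_loss_on_def intro: differentiable_imp_continuous_on)
  moreover have "regret K T f w = (\<Sum>t=1..T. f t (w t) - f t u)"
    by (simp add: regret_def u_def sum_subtractf)
  moreover have "f t (w t) - f t u \<le> gradient_within K (f t) (w t) \<bullet> (w t - u)"
    if t: "t \<in> {1..T}" for t
  proof -
    have "f t (w t) + gradient_within K (f t) (w t) \<bullet> (u - w t) \<le> f t u"
      using loss[OF t] w[OF t] \<open>u \<in> K\<close> by (auto simp: convex_loss_on_def)
    then show ?thesis
      by (simp add: inner_diff_right)
  qed
  ultimately show ?thesis
    by (intro that[of u]) (auto intro: sum_mono)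
qed

theorem theorem4:
  fixes T :: nat and D G S \<eta> :: real
    and K :: "(real ^ 'd) set"
    and f :: "nat \<Rightarrow> real ^ 'd \<Rightarrow> real"
    and w :: "nat \<Rightarrow> real ^ 'd"
  assumes "T \<ge> 1" and "D > 0" and "G > 0"
    and "K = {w. norm w \<le> D / 2}"
    and "\<forall>t\<in>{1..T}. convex_loss_on K (f t)"
    and "\<forall>t\<in>{1..T}. \<forall>w\<in>K. norm (gradient_within K (f t) w) \<le> G"
    and "S \<in> {0..D * T}"
    and "\<eta> = (if S \<in> {D * sqrt T..D * T} then D / (G * sqrt T) else S / (G * T))"
    and "w 1 \<in> K"
    and "\<forall>t\<in>{1..<T}. w (t + 1) =
           euclidean_projection K (w t - \<eta> *\<^sub>R gradient_within K (f t) (w t))"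
  shows "(\<Sum>t=2..T. norm (w t - w (t - 1))) \<le> S \<and>
         regret K T f w \<le>
           (if S \<in> {D * sqrt T..D * T} then D * G * sqrt T
            else if S \<in> {D..<D * sqrt T} then D * G * (D * T / S)
            else D * G * T)"
proof -
  define g where "g t = gradient_within K (f t) (w t)" for t
  have K_eq: "K = cball 0 (D / 2)"
    using assms(4) by auto
  then have K: "convex K" "closed K" "compact K"
    by auto
  have T: "real T > 0" "sqrt T > 0" "sqrt T * sqrt T = T"
    using assms(1) by auto
  have step: "w (Suc t) = closest_point K (w t - \<eta> *\<^sub>R g t)" if "t \<in> {1..<T}" for t
    using assms(10) that by (simp add: euclidean_projection_eq_closest_point g_def)
  have mem: "w t \<in> K" if "t \<in> {1..T}" for t
    using projected_iterates_mem[OF K(2) assms(9) step that] .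
  have g_le: "norm (g t) \<le> G" if "t \<in> {1..T}" for t
    using assms(6) mem that by (auto simp: g_def)
  have S: "0 \<le> S" "S \<le> D * T"
    using assms(7) by auto
  have "0 \<le> \<eta>"
    using assms(2,3,8) S T by auto
  obtain u where u: "u \<in> K" "regret K T f w \<le> (\<Sum>t=1..T. g t \<bullet> (w t - u))"
    unfolding g_def using regret_le_linear_regret[of K T f w] K(3) mem assms(5,9) by blast
  have diam: "norm (w t - u) \<le> D" if "t \<in> {1..T}" for t
    using norm_triangle_ineq4[of "w t" u] mem[OF that] u(1) assms(4) by simp

  have "(\<Sum>t=2..T. norm (w t - w (t - 1))) \<le> T * (\<eta> * G)"
    using K \<open>0 \<le> \<eta>\<close> assms(3) mem g_le step
    by (intro projected_descent_path_length) auto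
  \<comment> \<open>For a large budget the left side is \<open>D * sqrt T\<close>; otherwise
    \<open>\<eta>\<close> is chosen to make it exactly \<open>S\<close>.\<close>
  also have "T * (\<eta> * G) \<le> S"
  proof (cases "D * sqrt T \<le> S")
    case True
    then have "T * (\<eta> * G) = D * (real T / sqrt T)"
      using assms(3,8) S by simp
    then show ?thesis
      using True by (simp add: real_div_sqrt)
  next
    case False
    then show ?thesis
      using assms(3,8) T by simp
  qed
  finally have path: "(\<Sum>t=2..T. norm (w t - w (t - 1))) \<le> S" .

  \<comment> \<open>Positivity is a premise because \<open>S = 0\<close> gives
    \<open>\<eta> = 0\<close>; that value falls under the case \<open>S < D\<close>, which avoids
    this bound.\<close>
  have regret_le: "regret K T f w \<le> D\<^sup>2 / (2 * \<eta>) + \<eta> * G\<^sup>2 * T / 2" if "0 < \<eta>"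
  proof -
    have "(norm (w 1 - u))\<^sup>2 / (2 * \<eta>) \<le> D\<^sup>2 / (2 * \<eta>)"
      using diam[of 1] assms(1) that by (intro divide_right_mono power_mono) auto
    moreover have "(\<Sum>t=1..T. g t \<bullet> (w t - u))
        \<le> (norm (w 1 - u))\<^sup>2 / (2 * \<eta>) + \<eta> * G\<^sup>2 * T / 2"
      using K u(1) that assms(1) g_le step by (intro projected_descent_linear_regret) auto
    ultimately show ?thesis
      using u(2) by simp
  qed
  consider (large) "D * sqrt T \<le> S" | (medium) "S < D * sqrt T" "D \<le> S"
    | (small) "S < D * sqrt T" "S < D"
    by linarith
  then have "regret K T f w \<le>
           (if S \<in> {D * sqrt T..D * T} then D * G * sqrt T
            else if S \<in> {D..<D * sqrt T} then D * G * (D * T / S)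
            else D * G * T)"
  proof cases
    case large
    then have \<eta>: "\<eta> = D / (G * sqrt T)"
      using assms(8) S by simp
    \<comment> \<open>This \<open>\<eta>\<close> balances the two terms: each contributes half of
      \<open>D * G * sqrt T\<close>.\<close>
    have "\<eta> * G\<^sup>2 * T = D * G * (real T / sqrt T)" "D\<^sup>2 / (2 * \<eta>) = D * G * sqrt T / 2"
      using assms(2,3) T by (simp_all add: \<eta> field_simps power2_eq_square)
    then have "D\<^sup>2 / (2 * \<eta>) + \<eta> * G\<^sup>2 * T / 2 = D * G * sqrt T"
      by (simp add: real_div_sqrt)
    moreover have "0 < \<eta>"
      using assms(2,3) T by (simp add: \<eta>)
    ultimately show ?thesis
      using regret_le large S by simp
  next
    case medium
    then have \<eta>: "\<eta> = S / (G * T)" and "0 < S"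
      using assms(2,8) by auto
    then have "0 < \<eta>"
      using assms(3) T by simp
    \<comment> \<open>Below \<open>D * sqrt T\<close> the step is shorter than the balancing one, so
      the term \<open>G * S / 2\<close> is dominated by the distance term, and twice the latter is
      the claimed bound.\<close>
    have "S * S \<le> (D * sqrt T) * (D * sqrt T)"
      using medium S by (intro mult_mono) auto
    then have "S * S \<le> D * D * T"
      by (simp add: algebra_simps)
    then have "S \<le> D * D * T / S"
      using \<open>0 < S\<close> by (simp add: field_simps)
    then have "G * S \<le> G * (D * D * T / S)"
      using assms(3) by (intro mult_left_mono) auto
    moreover have "\<eta> * G\<^sup>2 * T = G * S" "D\<^sup>2 / (2 * \<eta>) = G * (D * D * T / S) / 2"
      using assms(3) T \<open>0 < S\<close> by (simp_all add: \<eta> field_simps power2_eq_square)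
    ultimately have "D\<^sup>2 / (2 * \<eta>) + \<eta> * G\<^sup>2 * T / 2 \<le> G * (D * D * T / S)"
      by simp
    then show ?thesis
      using regret_le[OF \<open>0 < \<eta>\<close>] medium by (simp add: mult_ac)
  next
    case small
    \<comment> \<open>Cauchy-Schwarz with the diameter bound handles each round separately, whatever
      the step size.\<close>
    have "g t \<bullet> (w t - u) \<le> G * D" if "t \<in> {1..T}" for t
      using norm_cauchy_schwarz[of "g t" "w t - u"]
        mult_mono[OF g_le[OF that] diam[OF that]] assms(3) by simp
    then have "(\<Sum>t=1..T. g t \<bullet> (w t - u)) \<le> (\<Sum>t=1..T. G * D)"
      by (intro sum_mono)
    then show ?thesis
      using u(2) small by (simp add: mult_ac)
  qed
  with path show ?thesis
    by blast
qed

end
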